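(* Let the growth condition (defined in the context) hold for the family $\mathcal S_{0,\infty}$. The following are equivalent: (i) the impulsive system is strongly UGES over $\mathcal S_{0,\infty}$; (ii) there exist $p\ge1$, $c\ge1$, $\eta>0$, $\mu\in(0,1)$ and a time-independent functional $V:X\to\mathbb R_{\ge0}$, Lipschitz on bounded subsets of $X$, such that for all $x\in X$ $$\|x\|^p\le V(x)\le c\|x\|^p,\qquad \underline D^+V(x)\le-\eta V(x),\qquad V(Jx)\le\mu V(x);$$ (iii) there exist $p\ge1$, $c\ge1$, $\eta>0$, $\mu\in(0,1)$ and $V:X\to\mathbb R_{\ge0}$, Lipschitz on bounded subsets of $X$, such that for all $x\in X$ $$\|x\|^p\le V(x)\le c\|x\|^p,\qquad V(S(t)x)\le e^{-\eta t}V(x)\ \ \forall t\ge0,\qquad V(Jx)\le\mu V(x);$$ and the same functional $V$ as in (ii) can be used in (iii).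
   Context: Setting. $X$ is a Banach space with norm $\|\cdot\|$; $A:D(A)\subset X\to X$ generates a strongly continuous ($C_0$) semigroup $(S(t))_{t\ge0}$ on $X$; $J\in L(X)$ is bounded, $J\neq0$, $JD(A)\subset D(A)$. $\mathcal S_{0,\infty}$ is the set of sequences $\sigma=\{t_k\}_{k\ge1}$ with, setting $t_0:=0$, $t_{k+1}>t_k$ for all $k\ge0$ and $t_k\to\infty$; $\mathbb T_\sigma:=\{t_k:k\ge1\}$. The impulsive system is $\dot x(t)=Ax(t)$ for $t\notin\mathbb T_\sigma$, $x(t)=Jx(t^-)$ for $t\in\mathbb T_\sigma$. Its propagator $U_\sigma(t,s)$, $t\ge s\ge0$, is: $U_\sigma(t,s)=S(t-s)$ if $(s,t]\cap\mathbb T_\sigma=\varnothing$; otherwise, if $t_l<\dots<t_m$ are the impulse times in $(s,t]$, $U_\sigma(t,s)=S(t-t_m)JS(t_m-t_{m-1})J\cdots JS(t_l-s)$. $\kappa_\sigma(t,s):=\#(\mathbb T_\sigma\cap(s,t])$. Strong UGES over a family $\mathcal S\subset\mathcal S_{0,\infty}$: there exist $M\ge1$, $\alpha>0$, $\rho\in(0,1)$ such that $\|U_\sigma(t,s)\|\le M\rho^{\kappa_\sigma(t,s)}e^{-\alpha(t-s)}$ for all $t\ge s\ge0$ and all $\sigma\in\mathcal S$. Growth condition for $\mathcal S_{0,\infty}$: there exist a piecewise continuous $g:\mathbb R_{\ge0}\to\mathbb R_{>0}$ bounded below by some $c_0>0$, and $\mu_0>1$, such that $\|U_\sigma(t,s)x\|\le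 g(t-s)\mu_0^{\kappa_\sigma(t,s)}\|x\|$ for all $t\ge s\ge0$, $x\in X$, $\sigma\in\mathcal S_{0,\infty}$, and $\sup_{\tau\ge0}g(\tau)<\infty$. $V:X\to\mathbb R_{\ge0}$ is Lipschitz on bounded subsets if for every $r>0$ there is $L_r>0$ with $|V(x)-V(y)|\le L_r\|x-y\|$ whenever $\|x\|<r$, $\|y\|<r$. $\underline D^+V(x):=\liminf_{h\downarrow0}h^{-1}\big(V(S(h)x)-V(x)\big)$. *)

theory Defs
  imports "HOL-Analysis.Analysis"
begin

definition C0_semigroup :: "(real \<Rightarrow> 'a::banach \<Rightarrow>\<^sub>L 'a) \<Rightarrow> bool" where
  "C0_semigroup S \<longleftrightarrow>
     S 0 = id_blinfun \<and>
     (\<forall>s\<ge>0. \<forall>t\<ge>0. S (s + t) = S s o\<^sub>L S t) \<and>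
     (\<forall>x. ((\<lambda>h. blinfun_apply (S h) x) \<longlongrightarrow> x) (at_right 0))"

text \<open>The unbounded operator \<open>A : D \<rightarrow> X\<close> is a total function together with its domain; values of
  \<open>A\<close> outside \<open>D\<close> are irrelevant.\<close>

definition generates :: "'a::banach set \<Rightarrow> ('a \<Rightarrow> 'a) \<Rightarrow> (real \<Rightarrow> 'a \<Rightarrow>\<^sub>L 'a) \<Rightarrow> bool" where
  "generates D A S \<longleftrightarrow>
     C0_semigroup S \<and>
     D = {x. \<exists>y. ((\<lambda>h. (blinfun_apply (S h) x - x) /\<^sub>R h) \<longlongrightarrow> y) (at_right 0)} \<and>
     (\<forall>x\<in>D. ((\<lambda>h. (blinfun_apply (S h) x - x) /\<^sub>R h) \<longlongrightarrow> A x) (at_right 0))"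

text \<open>The convention \<open>t\<^sub>0 = 0\<close> is built into the sequence; the entry at index \<open>0\<close> is not an impulse
  time.\<close>

definition impulse_seqs :: "(nat \<Rightarrow> real) set" where
  "impulse_seqs =
     {\<sigma>. \<sigma> 0 = 0 \<and> (\<forall>k. \<sigma> k < \<sigma> (Suc k)) \<and> filterlim \<sigma> at_top sequentially}"

definition impulse_times :: "(nat \<Rightarrow> real) \<Rightarrow> real set" where
  "impulse_times \<sigma> = \<sigma> ` {1..}"

definition impulses_in :: "(nat \<Rightarrow> real) \<Rightarrow> real \<Rightarrow> real \<Rightarrow> real set" where
  "impulses_in \<sigma> t s = impulse_times \<sigma> \<inter> {s<..t}"

lemma finite_impulses_in:
  assumes "\<sigma> \<in> impulse_seqs"
  shows "finite (impulses_in \<sigma> t s)"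
proof -
  from assms have "eventually (\<lambda>k. \<sigma> k \<ge> t + 1) sequentially"
    by (simp add: impulse_seqs_def filterlim_at_top)
  then obtain N where N: "\<And>k. k \<ge> N \<Longrightarrow> \<sigma> k \<ge> t + 1"
    by (auto simp: eventually_sequentially)
  have "k < N" if "\<sigma> k \<le> t" for k
    using N[of k] that by (cases "k < N") auto
  then have "impulses_in \<sigma> t s \<subseteq> \<sigma> ` {..<N}"
    by (auto simp: impulses_in_def impulse_times_def)
  then show ?thesis
    by (rule finite_subset) simp
qed

definition kappa :: "(nat \<Rightarrow> real) \<Rightarrow> real \<Rightarrow> real \<Rightarrow> nat" where
  "kappa \<sigma> t s = card (impulses_in \<sigma> t s)"

text \<open>For impulse times \<open>\<tau>\<^sub>l < \<dots> < \<tau>\<^sub>m\<close> the recursion yields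
  \<open>S (t - \<tau>\<^sub>m) J S (\<tau>\<^sub>m - \<tau>\<^sub>m\<^sub>-\<^sub>1) J \<dots> J S (\<tau>\<^sub>l - s)\<close>.\<close>

primrec flow_through ::
  "(real \<Rightarrow> 'a::banach \<Rightarrow>\<^sub>L 'a) \<Rightarrow> ('a \<Rightarrow>\<^sub>L 'a) \<Rightarrow> real list \<Rightarrow> real \<Rightarrow> real \<Rightarrow> 'a \<Rightarrow>\<^sub>L 'a" where
  "flow_through S J [] t s = S (t - s)"
| "flow_through S J (\<tau> # \<tau>s) t s = flow_through S J \<tau>s t \<tau> o\<^sub>L J o\<^sub>L S (\<tau> - s)"

definition propagator ::
  "(real \<Rightarrow> 'a::banach \<Rightarrow>\<^sub>L 'a) \<Rightarrow> ('a \<Rightarrow>\<^sub>L 'a) \<Rightarrow> (nat \<Rightarrow> real) \<Rightarrow> real \<Rightarrow> real \<Rightarrow> 'a \<Rightarrow>\<^sub>L 'a" where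
  "propagator S J \<sigma> t s = flow_through S J (sorted_list_of_set (impulses_in \<sigma> t s)) t s"

definition strongly_UGES ::
  "(real \<Rightarrow> 'a::banach \<Rightarrow>\<^sub>L 'a) \<Rightarrow> ('a \<Rightarrow>\<^sub>L 'a) \<Rightarrow> (nat \<Rightarrow> real) set \<Rightarrow> bool" where
  "strongly_UGES S J F \<longleftrightarrow>
     (\<exists>M \<alpha> \<rho>. M \<ge> 1 \<and> \<alpha> > 0 \<and> 0 < \<rho> \<and> \<rho> < 1 \<and>
        (\<forall>\<sigma>\<in>F. \<forall>t s. t \<ge> s \<and> s \<ge> 0 \<longrightarrow>
           norm (propagator S J \<sigma> t s) \<le> M * \<rho> ^ kappa \<sigma> t s * exp (- \<alpha> * (t - s))))"

text \<open>Piecewise continuity on \<open>[0, \<infinity>)\<close>: finitely many discontinuities on each bounded interval, and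
  finite one-sided limits everywhere.\<close>

definition piecewise_continuous_nonneg :: "(real \<Rightarrow> real) \<Rightarrow> bool" where
  "piecewise_continuous_nonneg g \<longleftrightarrow>
     (\<forall>T. finite {\<tau> \<in> {0..T}. \<not> continuous (at \<tau> within {0..}) g}) \<and>
     (\<forall>\<tau>\<ge>0. \<exists>l. (g \<longlongrightarrow> l) (at_right \<tau>)) \<and>
     (\<forall>\<tau>>0. \<exists>l. (g \<longlongrightarrow> l) (at_left \<tau>))"

definition growth_condition ::
  "(real \<Rightarrow> 'a::banach \<Rightarrow>\<^sub>L 'a) \<Rightarrow> ('a \<Rightarrow>\<^sub>L 'a) \<Rightarrow> (nat \<Rightarrow> real) set \<Rightarrow> bool" where
  "growth_condition S J F \<longleftrightarrow>
     (\<exists>g c\<^sub>0 \<mu>\<^sub>0. piecewise_continuous_nonneg g \<and>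
        c\<^sub>0 > 0 \<and> (\<forall>\<tau>\<ge>0. g \<tau> \<ge> c\<^sub>0) \<and> bdd_above (g ` {0..}) \<and> \<mu>\<^sub>0 > 1 \<and>
        (\<forall>\<sigma>\<in>F. \<forall>t s x. t \<ge> s \<and> s \<ge> 0 \<longrightarrow>
           norm (blinfun_apply (propagator S J \<sigma> t s) x)
             \<le> g (t - s) * \<mu>\<^sub>0 ^ kappa \<sigma> t s * norm x))"

definition lipschitz_on_bounded :: "('a::banach \<Rightarrow> real) \<Rightarrow> bool" where
  "lipschitz_on_bounded V \<longleftrightarrow> (\<forall>r>0. \<exists>L>0. L-lipschitz_on (ball 0 r) V)"

text \<open>The lower right Dini derivative along the semigroup may be infinite, hence \<open>ereal\<close>.\<close>

definition lower_dini ::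
  "(real \<Rightarrow> 'a::banach \<Rightarrow>\<^sub>L 'a) \<Rightarrow> ('a \<Rightarrow> real) \<Rightarrow> 'a \<Rightarrow> ereal" where
  "lower_dini S V x =
     Liminf (at_right 0) (\<lambda>h. ereal ((V (blinfun_apply (S h) x) - V x) / h))"

definition lyapunov_infinitesimal ::
  "(real \<Rightarrow> 'a::banach \<Rightarrow>\<^sub>L 'a) \<Rightarrow> ('a \<Rightarrow>\<^sub>L 'a) \<Rightarrow> real \<Rightarrow> real \<Rightarrow> real \<Rightarrow> real \<Rightarrow> ('a \<Rightarrow> real) \<Rightarrow> bool"
  where
  "lyapunov_infinitesimal S J p c \<eta> \<mu> V \<longleftrightarrow>
     p \<ge> 1 \<and> c \<ge> 1 \<and> \<eta> > 0 \<and> 0 < \<mu> \<and> \<mu> < 1 \<and>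
     (\<forall>x. V x \<ge> 0) \<and> lipschitz_on_bounded V \<and>
     (\<forall>x. norm x powr p \<le> V x \<and> V x \<le> c * norm x powr p \<and>
          lower_dini S V x \<le> ereal (- \<eta> * V x) \<and>
          V (blinfun_apply J x) \<le> \<mu> * V x)"

definition lyapunov_decay ::
  "(real \<Rightarrow> 'a::banach \<Rightarrow>\<^sub>L 'a) \<Rightarrow> ('a \<Rightarrow>\<^sub>L 'a) \<Rightarrow> real \<Rightarrow> real \<Rightarrow> real \<Rightarrow> real \<Rightarrow> ('a \<Rightarrow> real) \<Rightarrow> bool"
  where
  "lyapunov_decay S J p c \<eta> \<mu> V \<longleftrightarrow>
     p \<ge> 1 \<and> c \<ge> 1 \<and> \<eta> > 0 \<and> 0 < \<mu> \<and> \<mu> < 1 \<and>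
     (\<forall>x. V x \<ge> 0) \<and> lipschitz_on_bounded V \<and>
     (\<forall>x. norm x powr p \<le> V x \<and> V x \<le> c * norm x powr p \<and>
          (\<forall>t\<ge>0. V (blinfun_apply (S t) x) \<le> exp (- \<eta> * t) * V x) \<and>
          V (blinfun_apply J x) \<le> \<mu> * V x)"

end

theory Submission
  imports Defs
begin

text \<open>
  The Lyapunov estimates can be read off along one trajectory. If \<open>V\<close> shrinks by the factor
  \<open>exp (- \<eta> * t)\<close> along the semigroup and by \<open>\<mu>\<close> at each jump, then multiplying these factors over
  the pieces of a trajectory bounds \<open>V\<close> at its end, and the two-sided comparison of \<open>V\<close> with
  \<open>norm x powr p\<close> turns this into a bound on the propagator after taking the \<open>p\<close>-th root
  (\<open>lyapunov_decay_imp_strongly_UGES\<close>).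

  Conversely, strong UGES says that the norm at the end of a trajectory, divided by its guaranteed
  decay \<open>\<rho> ^ k * exp (- \<alpha> * (t - s))\<close>, never exceeds \<open>M * norm x\<close>. The supremum \<open>V x\<close> of these
  rescaled norms over all impulse patterns and all durations is a norm equivalent to the given one,
  hence Lipschitz. It decays along the semigroup, because flowing for a time \<open>h\<close> and then following
  a pattern is again following a pattern, which started \<open>h\<close> earlier. The same argument for the jump
  would need a pattern with an impulse at its initial time, and impulses happen only strictly later.
  So the jump is preceded by a flow of length \<open>h > 0\<close>, and strong continuity of the semigroup lets
  \<open>h\<close> tend to \<open>0\<close> (\<open>strongly_UGES_imp_lyapunov_decay\<close>). Since the family contains every impulse
  sequence, every finite pattern in positive time occurs in it (\<open>impulse_list_realized\<close>); this is
  what closes the family under prepending a flow or a jump.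

  The infinitesimal and the integrated decay conditions are equivalent for each single \<open>V\<close>. Orbits
  of the semigroup are continuous, hence so is \<open>V\<close> along an orbit, and a continuous function whose
  lower right Dini derivative is at most \<open>- \<eta>\<close> times its value decays exponentially
  (\<open>lower_dini_exponential_decay\<close>). The other direction differentiates the exponential at \<open>0\<close>.
\<close>

section \<open>Impulse patterns as strictly increasing lists\<close>

text \<open>
  The impulses of one trajectory, without reference to an infinite impulse sequence. A list matches
  the recursion of the propagator, and the start \<open>s\<close> may be negative, so that a pattern can be
  extended into the past.
\<close>

definition impulse_list :: "real \<Rightarrow> real list \<Rightarrow> real \<Rightarrow> bool" where
  "impulse_list s \<tau>s t \<longleftrightarrow> s \<le> t \<and> sorted_wrt (<) \<tau>s \<and> set \<tau>s \<subseteq> {s<..t}"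

lemma impulse_list_Nil [simp]: "impulse_list s [] t \<longleftrightarrow> s \<le> t"
  by (simp add: impulse_list_def)

lemma impulse_list_Cons [simp]:
  "impulse_list s (\<tau> # \<tau>s) t \<longleftrightarrow> s < \<tau> \<and> impulse_list \<tau> \<tau>s t"
  by (auto simp: impulse_list_def)

lemma impulse_list_le: "impulse_list s \<tau>s t \<Longrightarrow> s \<le> t"
  by (simp add: impulse_list_def)

lemma impulse_list_shift:
  "impulse_list (s + h) (map (\<lambda>\<tau>. \<tau> + h) \<tau>s) (t + h) \<longleftrightarrow> impulse_list s \<tau>s t"
  by (induction \<tau>s arbitrary: s) auto

lemma impulse_list_earlier:
  "impulse_list s \<tau>s t \<Longrightarrow> r \<le> s \<Longrightarrow> impulse_list r \<tau>s t"
  by (cases \<tau>s) auto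

lemma flow_through_shift:
  "flow_through S J (map (\<lambda>\<tau>. \<tau> + h) \<tau>s) (t + h) (s + h) = flow_through S J \<tau>s t s"
  by (induction \<tau>s arbitrary: s) simp_all

lemma impulse_list_propagator:
  assumes "\<sigma> \<in> impulse_seqs" "s \<le> t"
  shows "impulse_list s (sorted_list_of_set (impulses_in \<sigma> t s)) t"
  using finite_impulses_in[OF assms(1), of t s] assms(2)
  by (auto simp: impulse_list_def impulses_in_def)

text \<open>
  Past the end of the list the sequence continues with unit steps beyond \<open>t\<close>, which makes it tend to
  infinity without adding impulses up to time \<open>t\<close>.
\<close>

lemma impulse_list_realized:
  assumes "impulse_list 0 \<tau>s t"
  obtains \<sigma> where "\<sigma> \<in> impulse_seqs" "kappa \<sigma> t 0 = length \<tau>s"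
    "propagator S J \<sigma> t 0 = flow_through S J \<tau>s t 0"
proof -
  define n where "n = length \<tau>s"
  define \<sigma> where "\<sigma> k = (if k \<le> n then (0 # \<tau>s) ! k else (t - real n) + real k)" for k
  have sorted: "sorted_wrt (<) (0 # \<tau>s)" and sub: "set \<tau>s \<subseteq> {0<..t}" and "0 \<le> t"
    using assms by (auto simp: impulse_list_def)
  have le: "(0 # \<tau>s) ! k \<le> t" if "k \<le> n" for k
  proof -
    have "(0 # \<tau>s) ! k \<in> set (0 # \<tau>s)"
      using that by (intro nth_mem) (simp add: n_def)
    then show ?thesis
      using sub \<open>0 \<le> t\<close> by auto
  qed
  have incr: "\<sigma> k < \<sigma> (Suc k)" for k
  proof (cases "Suc k \<le> n")
    case True
    then show ?thesis
      using sorted_wrt_nth_less[OF sorted, of k "Suc k"] by (simp add: \<sigma>_def n_def)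
  next
    case False
    then show ?thesis
      using le[of k] by (auto simp: \<sigma>_def)
  qed
  have "filterlim (\<lambda>k. (t - real n) + real k) at_top sequentially"
    by (rule filterlim_tendsto_add_at_top[OF tendsto_const filterlim_real_sequentially])
  moreover have "eventually (\<lambda>k. (t - real n) + real k = \<sigma> k) sequentially"
    using eventually_gt_at_top[of n] by eventually_elim (simp add: \<sigma>_def)
  ultimately have "filterlim \<sigma> at_top sequentially"
    by (rule filterlim_cong[OF refl refl, THEN iffD1, rotated])
  then have \<sigma>: "\<sigma> \<in> impulse_seqs"
    using incr by (simp add: impulse_seqs_def \<sigma>_def)
  have "impulses_in \<sigma> t 0 = set \<tau>s"
  proof (intro set_eqI iffI)
    fix y assume "y \<in> impulses_in \<sigma> t 0"
    then obtain k where k: "k \<ge> 1" "y = \<sigma> k" "\<sigma> k \<le> t"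
      by (auto simp: impulses_in_def impulse_times_def)
    then have "k \<le> n"
      by (auto simp: \<sigma>_def split: if_splits)
    with k show "y \<in> set \<tau>s"
      by (cases k) (auto simp: \<sigma>_def n_def)
  next
    fix y assume y: "y \<in> set \<tau>s"
    then obtain k where "k < n" "y = \<tau>s ! k"
      by (auto simp: in_set_conv_nth n_def)
    then have "y = \<sigma> (Suc k)"
      by (simp add: \<sigma>_def)
    with y sub show "y \<in> impulses_in \<sigma> t 0"
      by (auto simp: impulses_in_def impulse_times_def)
  qed
  moreover have "sorted_list_of_set (set \<tau>s) = \<tau>s" "card (set \<tau>s) = length \<tau>s"
    using assms by (auto simp: impulse_list_def strict_sorted_iff distinct_card
        sorted_list_of_set.idem_if_sorted_distinct)
  ultimately show ?thesis
    using that[OF \<sigma>] by (simp add: kappa_def propagator_def)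
qed

section \<open>Continuity of orbits\<close>

text \<open>
  Some admissible impulse sequence has no impulse up to time \<open>t\<close>; there the propagator is the
  semigroup and the jump factor is \<open>1\<close>.
\<close>

lemma growth_condition_bounds_semigroup:
  assumes "growth_condition S J impulse_seqs"
  obtains G where "\<And>t x. t \<ge> 0 \<Longrightarrow> norm (blinfun_apply (S t) x) \<le> G * norm x"
proof -
  obtain g :: "real \<Rightarrow> real" and \<mu>\<^sub>0 where bdd: "bdd_above (g ` {0..})" and
    bound: "\<And>\<sigma> t s x. \<sigma> \<in> impulse_seqs \<Longrightarrow> t \<ge> s \<Longrightarrow> s \<ge> 0 \<Longrightarrow>
       norm (blinfun_apply (propagator S J \<sigma> t s) x) \<le> g (t - s) * \<mu>\<^sub>0 ^ kappa \<sigma> t s * norm x"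
    using assms unfolding growth_condition_def by blast
  obtain G where G: "\<And>t. t \<ge> 0 \<Longrightarrow> g t \<le> G"
    using bdd by (auto simp: bdd_above_def)
  have "norm (blinfun_apply (S t) x) \<le> G * norm x" if "t \<ge> 0" for t x
  proof -
    obtain \<sigma> where "\<sigma> \<in> impulse_seqs" "kappa \<sigma> t 0 = 0"
      "propagator S J \<sigma> t 0 = flow_through S J [] t 0"
      by (rule impulse_list_realized[of "[]" t S J]) (use \<open>t \<ge> 0\<close> in auto)
    then have "norm (blinfun_apply (S t) x) \<le> g t * norm x"
      using bound[of \<sigma> 0 t x] that by simp
    also have "\<dots> \<le> G * norm x"
      using G[OF that] by (intro mult_right_mono) auto
    finally show ?thesis .
  qed
  then show ?thesis
    using that by blast
qed

text \<open>
  Strong continuity gives continuity at \<open>0\<close> only. By the semigroup law, an increment of the orbit is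
  the image under \<open>S (min r t)\<close> of an increment at \<open>0\<close>, so a uniform bound on the semigroup carries
  continuity to all times, from the left as well as from the right.
\<close>

lemma C0_semigroup_orbit_continuous:
  assumes C0: "C0_semigroup S"
    and G: "\<And>t x. t \<ge> 0 \<Longrightarrow> norm (blinfun_apply (S t) x) \<le> G * norm x"
  shows "continuous_on {0..} (\<lambda>t. blinfun_apply (S t) x)"
proof -
  have diff: "norm (blinfun_apply (S r) x - blinfun_apply (S t) x)
      \<le> G * norm (blinfun_apply (S \<bar>r - t\<bar>) x - x)" if "r \<ge> 0" "t \<ge> 0" for r t
  proof -
    have *: "norm (blinfun_apply (S (a + h)) x - blinfun_apply (S a) x)
        \<le> G * norm (blinfun_apply (S h) x - x)" if "a \<ge> 0" "h \<ge> 0" for a h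
      using G[OF that(1), of "blinfun_apply (S h) x - x"] C0 that
      by (simp add: C0_semigroup_def blinfun.diff_right)
    show ?thesis
      using *[of t "r - t"] *[of r "t - r"] that
      by (cases "r \<ge> t") (auto simp: abs_if norm_minus_commute)
  qed
  have lim0: "((\<lambda>h. blinfun_apply (S h) x) \<longlongrightarrow> x) (at 0 within {0..})"
    using C0 by (simp add: C0_semigroup_def at_within_Ici_at_right)
  have S0: "blinfun_apply (S 0) x = x"
    using C0 by (simp add: C0_semigroup_def)
  have "((\<lambda>r. blinfun_apply (S r) x) \<longlongrightarrow> blinfun_apply (S t) x) (at t within {0..})"
    if "t \<ge> 0" for t
  proof -
    have cont0: "continuous (at 0 within {0..}) (\<lambda>h. blinfun_apply (S h) x)"
      using lim0 S0 by (simp add: continuous_within)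
    have "((\<lambda>r. \<bar>r - t\<bar>) \<longlongrightarrow> 0) (at t within {0..})"
      by (auto intro!: tendsto_eq_intros)
    then have "((\<lambda>r. blinfun_apply (S \<bar>r - t\<bar>) x) \<longlongrightarrow> blinfun_apply (S 0) x) (at t within {0..})"
      by (intro continuous_within_tendsto_compose[OF cont0]) auto
    then have "((\<lambda>r. G * norm (blinfun_apply (S \<bar>r - t\<bar>) x - x)) \<longlongrightarrow> G * norm (x - x))
        (at t within {0..})"
      unfolding S0 by (intro tendsto_intros)
    then have "((\<lambda>r. G * norm (blinfun_apply (S \<bar>r - t\<bar>) x - x)) \<longlongrightarrow> 0) (at t within {0..})"
      by simp
    moreover have "eventually (\<lambda>r. norm (blinfun_apply (S r) x - blinfun_apply (S t) x)
        \<le> G * norm (blinfun_apply (S \<bar>r - t\<bar>) x - x)) (at t within {0..})"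
      using diff that by (auto simp: eventually_at_filter)
    ultimately have "((\<lambda>r. blinfun_apply (S r) x - blinfun_apply (S t) x) \<longlongrightarrow> 0) (at t within {0..})"
      by (rule Lim_null_comparison[rotated])
    then show ?thesis
      by (simp add: LIM_zero_iff)
  qed
  then show ?thesis
    by (simp add: continuous_on_def)
qed

section \<open>From the Dini inequality to exponential decay\<close>

text \<open>
  It suffices to beat every comparison function \<open>b t = exp (- \<theta> * t) * (v 0 + \<epsilon>)\<close> with \<open>\<theta> < \<eta>\<close> and
  \<open>\<epsilon> > 0\<close>. Consider the last time up to \<open>T\<close> at which \<open>v \<le> b\<close>. A lower limit controls \<open>v\<close> only at
  some times \<open>h\<close> arbitrarily close to \<open>0\<close>, but one such time is enough to contradict the choice of
  the last time. The slack \<open>\<theta> < \<eta>\<close> makes the Dini inequality strict where \<open>v\<close> touches \<open>b\<close>, and the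
  slack \<open>\<epsilon>\<close> keeps \<open>b\<close> positive, which this strictness needs.
\<close>

lemma lower_dini_exponential_decay:
  fixes v :: "real \<Rightarrow> real"
  assumes cont: "continuous_on {0..} v" and v0: "v 0 \<ge> 0"
    and dini: "\<And>t. t \<ge> 0 \<Longrightarrow>
      Liminf (at_right 0) (\<lambda>h. ereal ((v (t + h) - v t) / h)) \<le> ereal (- \<eta> * v t)"
    and "T \<ge> 0"
  shows "v T \<le> exp (- \<eta> * T) * v 0"
proof -
  have main: "v T \<le> exp (- \<theta> * T) * (v 0 + \<epsilon>)" if "\<theta> < \<eta>" "\<epsilon> > 0" for \<theta> \<epsilon>
  proof -
    define b where "b t = exp (- \<theta> * t) * (v 0 + \<epsilon>)" for t
    have bpos: "b t > 0" for t
      using v0 that by (simp add: b_def)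
    have badd: "b (t + h) = exp (- \<theta> * h) * b t" for t h
      by (simp add: b_def exp_add[symmetric] algebra_simps)
    have cont': "continuous_on {0..} (\<lambda>t. v t - b t)"
      unfolding b_def by (intro continuous_intros cont)
    \<comment> \<open>The set need not be an interval; its supremum belongs to it because it is closed.\<close>
    define E where "E = {t \<in> {0..T}. v t - b t \<le> 0}"
    have "continuous_on {0..T} (\<lambda>t. v t - b t)"
      by (rule continuous_on_subset[OF cont']) auto
    then have "closed E"
      unfolding E_def by (intro continuous_on_closed_Collect_le continuous_on_const) auto
    moreover have "0 \<in> E"
      using that \<open>T \<ge> 0\<close> by (simp add: E_def b_def)
    moreover have bddE: "bdd_above E"
      by (auto simp: E_def bdd_above_def)
    ultimately have sup: "Sup E \<in> E"
      by (intro closed_contains_Sup) auto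
    define t where "t = Sup E"
    have t: "0 \<le> t" "t \<le> T" "v t \<le> b t"
      using sup by (auto simp: E_def t_def)
    have "\<not> t < T"
    proof
      assume "t < T"
      have fr: "\<exists>\<^sub>F h in at_right 0. v (t + h) \<le> b (t + h)"
      proof (cases "v t < b t")
        case True
        have "continuous_on {t..} (\<lambda>t. v t - b t)"
          by (rule continuous_on_subset[OF cont']) (use t in auto)
        then have "((\<lambda>r. v r - b r) \<longlongrightarrow> v t - b t) (at t within {t..})"
          unfolding continuous_on_def by (rule bspec) simp
        then have "((\<lambda>r. v r - b r) \<longlongrightarrow> v t - b t) (at_right t)"
          by (simp only: at_within_Ici_at_right)
        then have "\<forall>\<^sub>F r in at_right t. v r - b r < 0"
          by (rule order_tendstoD) (use True in simp)
        then have "\<forall>\<^sub>F h in at_right 0. v (t + h) - b (t + h) < 0"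
          by (subst (asm) eventually_at_right_to_0) (simp add: add.commute)
        then have "\<forall>\<^sub>F h in at_right 0. v (t + h) \<le> b (t + h)"
          by eventually_elim simp
        then show ?thesis
          by (rule eventually_frequently[rotated]) simp
      next
        case False
        with t have eq: "v t = b t"
          by simp
        have less: "Liminf (at_right 0) (\<lambda>h. ereal ((v (t + h) - v t) / h)) < ereal (- \<theta> * v t)"
          using dini[OF t(1)] that(1) bpos[of t] eq
          by (elim le_less_trans) simp
        have "\<not> (\<forall>\<^sub>F h in at_right 0. ereal (- \<theta> * v t) \<le> ereal ((v (t + h) - v t) / h))"
        proof
          assume "\<forall>\<^sub>F h in at_right 0. ereal (- \<theta> * v t) \<le> ereal ((v (t + h) - v t) / h)"
          then have "ereal (- \<theta> * v t) \<le> Liminf (at_right 0) (\<lambda>h. ereal ((v (t + h) - v t) / h))"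
            by (rule Liminf_bounded)
          from leD[OF this] less show False
            by (rule notE)
        qed
        then have "\<exists>\<^sub>F h in at_right 0. (v (t + h) - v t) / h < - \<theta> * v t"
          by (simp add: frequently_def not_less)
        moreover have "\<forall>\<^sub>F h in at_right (0::real). 0 < h"
          by (simp add: eventually_at_filter)
        ultimately have "\<exists>\<^sub>F h in at_right 0. 0 < h \<and> (v (t + h) - v t) / h < - \<theta> * v t"
          by (rule frequently_eventually_conj)
        then show ?thesis
        proof (rule frequently_elim1)
          fix h assume "0 < h \<and> (v (t + h) - v t) / h < - \<theta> * v t"
          then have "v (t + h) - b t < - \<theta> * b t * h"
            using pos_divide_less_eq[of h "v (t + h) - v t" "- \<theta> * v t"] by (simp add: eq)
          then have "v (t + h) \<le> (1 + - \<theta> * h) * b t"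
            by (simp add: algebra_simps)
          \<comment> \<open>The tangent of the exponential lies below it.\<close>
          also have "\<dots> \<le> b (t + h)"
            unfolding badd using bpos[of t] exp_ge_add_one_self[of "- \<theta> * h"]
            by (intro mult_right_mono) auto
          finally show "v (t + h) \<le> b (t + h)" .
        qed
      qed
      moreover have "\<forall>\<^sub>F h in at_right 0. 0 < h \<and> h < T - t"
        using \<open>t < T\<close> by (auto simp: eventually_at_right_field intro!: exI[of _ "T - t"])
      ultimately have "\<exists>\<^sub>F h in at_right 0. (0 < h \<and> h < T - t) \<and> v (t + h) \<le> b (t + h)"
        by (rule frequently_eventually_conj)
      then obtain h where h: "0 < h" "h < T - t" "v (t + h) \<le> b (t + h)"
        by (blast dest: frequently_ex)
      then have "t + h \<in> E"
        using t by (simp add: E_def)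
      then have "t + h \<le> t"
        unfolding t_def by (rule cSup_upper[OF _ bddE])
      with h show False
        by simp
    qed
    with t have "t = T"
      by simp
    with t show ?thesis
      by (simp add: b_def)
  qed
  \<comment> \<open>Both slacks vanish together: \<open>\<theta> = \<eta> - \<epsilon>\<close>.\<close>
  have "((\<lambda>\<epsilon>. exp (- (\<eta> - \<epsilon>) * T) * (v 0 + \<epsilon>)) \<longlongrightarrow> exp (- (\<eta> - 0) * T) * (v 0 + 0)) (at_right 0)"
    by (intro tendsto_intros)
  moreover have "\<forall>\<^sub>F \<epsilon> in at_right 0. v T \<le> exp (- (\<eta> - \<epsilon>) * T) * (v 0 + \<epsilon>)"
    by (intro eventually_at_rightI[of 0 1] main) auto
  ultimately show ?thesis
    using tendsto_lowerbound by force
qed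

lemma lipschitz_on_bounded_continuous:
  assumes "lipschitz_on_bounded V"
  shows "continuous_on UNIV V"
proof -
  have "continuous (at x) V" for x
  proof -
    obtain L where "L-lipschitz_on (ball 0 (norm x + 1)) V"
      using assms unfolding lipschitz_on_bounded_def
      by (meson add_nonneg_pos norm_ge_zero zero_less_one)
    then have "continuous_on (ball 0 (norm x + 1)) V"
      by (rule lipschitz_on_continuous_on)
    then show ?thesis
      by (simp add: continuous_on_eq_continuous_at)
  qed
  then show ?thesis
    by (simp add: continuous_on_eq_continuous_at)
qed

text \<open>
  By the semigroup law the difference quotients of \<open>V\<close> along an orbit at time \<open>r\<close> are those at time
  \<open>0\<close> for the starting point \<open>S r x\<close>, so the Dini condition at all points controls the orbit at all
  times.
\<close>

lemma lyapunov_infinitesimal_imp_decay: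
  assumes C0: "C0_semigroup S"
    and G: "\<And>t x. t \<ge> 0 \<Longrightarrow> norm (blinfun_apply (S t) x) \<le> G * norm x"
    and V: "lyapunov_infinitesimal S J p c \<eta> \<mu> V"
  shows "lyapunov_decay S J p c \<eta> \<mu> V"
proof -
  have "V (blinfun_apply (S t) x) \<le> exp (- \<eta> * t) * V x" if "t \<ge> 0" for t x
  proof -
    define v where "v r = V (blinfun_apply (S r) x)" for r
    have "continuous_on {0..} v"
      unfolding v_def using V
      by (intro continuous_on_compose2[OF lipschitz_on_bounded_continuous
            C0_semigroup_orbit_continuous[OF C0 G]])
         (auto simp: lyapunov_infinitesimal_def)
    moreover have "Liminf (at_right 0) (\<lambda>h. ereal ((v (r + h) - v r) / h)) \<le> ereal (- \<eta> * v r)"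
      if "r \<ge> 0" for r
    proof -
      have "\<forall>\<^sub>F h in at_right 0. ereal ((v (r + h) - v r) / h) =
          ereal ((V (blinfun_apply (S h) (blinfun_apply (S r) x)) - V (blinfun_apply (S r) x)) / h)"
        using C0 that
        by (intro eventually_at_rightI[of 0 1])
           (auto simp: v_def C0_semigroup_def add.commute[of r])
      then have "Liminf (at_right 0) (\<lambda>h. ereal ((v (r + h) - v r) / h)) =
          lower_dini S V (blinfun_apply (S r) x)"
        unfolding lower_dini_def by (rule Liminf_eq)
      also have "\<dots> \<le> ereal (- \<eta> * v r)"
        using V by (simp add: lyapunov_infinitesimal_def v_def)
      finally show ?thesis .
    qed
    moreover have "v 0 = V x" "V x \<ge> 0"
      using V C0 by (auto simp: v_def lyapunov_infinitesimal_def C0_semigroup_def)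
    ultimately show ?thesis
      using lower_dini_exponential_decay[of v \<eta> t] that by (simp add: v_def)
  qed
  with V show ?thesis
    by (simp add: lyapunov_infinitesimal_def lyapunov_decay_def)
qed

lemma lyapunov_decay_imp_infinitesimal:
  assumes V: "lyapunov_decay S J p c \<eta> \<mu> V"
  shows "lyapunov_infinitesimal S J p c \<eta> \<mu> V"
proof -
  have "lower_dini S V x \<le> ereal (- \<eta> * V x)" for x
  proof -
    have "((\<lambda>h. exp (- \<eta> * h) * V x) has_real_derivative - \<eta> * V x) (at 0)"
      by (auto intro!: derivative_eq_intros)
    then have "((\<lambda>h. (exp (- \<eta> * h) * V x - V x) / h) \<longlongrightarrow> - \<eta> * V x) (at_right 0)"
      by (auto simp: DERIV_def intro: filterlim_mono[OF _ order_refl at_le])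
    then have "Liminf (at_right 0) (\<lambda>h. ereal ((exp (- \<eta> * h) * V x - V x) / h)) =
        ereal (- \<eta> * V x)"
      by (intro lim_imp_Liminf) simp_all
    moreover have "lower_dini S V x \<le>
        Liminf (at_right 0) (\<lambda>h. ereal ((exp (- \<eta> * h) * V x - V x) / h))"
      unfolding lower_dini_def using V
      by (intro Liminf_mono eventually_at_rightI[of 0 1])
         (auto simp: lyapunov_decay_def intro!: divide_right_mono)
    ultimately show ?thesis
      by simp
  qed
  with V show ?thesis
    by (simp add: lyapunov_infinitesimal_def lyapunov_decay_def)
qed

section \<open>From a Lyapunov functional to strong stability\<close>

text \<open>The decay factors of the pieces of a trajectory multiply.\<close>

lemma lyapunov_decay_flow_through:
  assumes V: "lyapunov_decay S J p c \<eta> \<mu> V" and "impulse_list s \<tau>s t"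
  shows "V (blinfun_apply (flow_through S J \<tau>s t s) x)
      \<le> \<mu> ^ length \<tau>s * exp (- \<eta> * (t - s)) * V x"
  using assms(2)
proof (induction \<tau>s arbitrary: s x)
  case Nil
  then show ?case
    using V by (simp add: lyapunov_decay_def)
next
  case (Cons \<tau> \<tau>s)
  have \<mu>: "\<mu> > 0"
    using V by (simp add: lyapunov_decay_def)
  let ?y = "blinfun_apply (S (\<tau> - s)) x"
  have "V (blinfun_apply (flow_through S J (\<tau> # \<tau>s) t s) x)
      \<le> \<mu> ^ length \<tau>s * exp (- \<eta> * (t - \<tau>)) * V (blinfun_apply J ?y)"
    using Cons by simp
  also have "\<dots> \<le> \<mu> ^ length \<tau>s * exp (- \<eta> * (t - \<tau>)) * (\<mu> * V ?y)"
    using V \<mu> by (intro mult_left_mono) (auto simp: lyapunov_decay_def)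
  also have "\<dots> \<le> \<mu> ^ length \<tau>s * exp (- \<eta> * (t - \<tau>)) * (\<mu> * (exp (- \<eta> * (\<tau> - s)) * V x))"
    using V \<mu> Cons.prems by (intro mult_left_mono) (auto simp: lyapunov_decay_def)
  also have "\<dots> = \<mu> ^ length (\<tau> # \<tau>s) * (exp (- \<eta> * (t - \<tau>)) * exp (- \<eta> * (\<tau> - s))) * V x"
    by simp
  also have "exp (- \<eta> * (t - \<tau>)) * exp (- \<eta> * (\<tau> - s)) = exp (- \<eta> * (t - s))"
    by (simp add: exp_add[symmetric] algebra_simps)
  finally show ?case .
qed

lemma lyapunov_decay_imp_strongly_UGES:
  assumes V: "lyapunov_decay S J p c \<eta> \<mu> V"
  shows "strongly_UGES S J impulse_seqs"
proof -
  have pc: "p \<ge> 1" "c \<ge> 1" "\<eta> > 0" "0 < \<mu>" "\<mu> < 1"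
    using V by (auto simp: lyapunov_decay_def)
  define M \<rho> where "M = c powr (1 / p)" and "\<rho> = \<mu> powr (1 / p)"
  have "norm (propagator S J \<sigma> t s) \<le> M * \<rho> ^ kappa \<sigma> t s * exp (- (\<eta> / p) * (t - s))"
    if "\<sigma> \<in> impulse_seqs" "s \<le> t" for \<sigma> t s
  proof (rule norm_blinfun_bound)
    let ?k = "kappa \<sigma> t s"
    show "0 \<le> M * \<rho> ^ ?k * exp (- (\<eta> / p) * (t - s))"
      by (simp add: M_def \<rho>_def)
    fix x
    let ?y = "blinfun_apply (propagator S J \<sigma> t s) x"
    have "norm ?y powr p \<le> V ?y"
      using V by (simp add: lyapunov_decay_def)
    also have "\<dots> \<le> \<mu> ^ ?k * exp (- \<eta> * (t - s)) * V x"
      using lyapunov_decay_flow_through[OF V impulse_list_propagator[OF that], of x]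
      by (simp add: propagator_def kappa_def)
    also have "\<dots> \<le> \<mu> ^ ?k * exp (- \<eta> * (t - s)) * (c * norm x powr p)"
      using V pc by (intro mult_left_mono) (auto simp: lyapunov_decay_def)
    finally have "(norm ?y powr p) powr (1 / p)
        \<le> (\<mu> ^ ?k * exp (- \<eta> * (t - s)) * (c * norm x powr p)) powr (1 / p)"
      using pc by (intro powr_mono2) auto
    moreover have "(norm z powr p) powr (1 / p) = norm z" for z :: 'a
      using pc by (simp add: powr_powr)
    moreover have "(\<mu> ^ ?k) powr (1 / p) = \<rho> ^ ?k"
      using pc by (simp add: \<rho>_def powr_realpow[symmetric] powr_powr mult.commute)
    moreover have "exp (- \<eta> * (t - s)) powr (1 / p) = exp (- (\<eta> / p) * (t - s))"
      by (simp add: powr_def)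
    ultimately show "norm ?y \<le> M * \<rho> ^ ?k * exp (- (\<eta> / p) * (t - s)) * norm x"
      using pc by (simp add: powr_mult M_def mult_ac)
  qed
  moreover have "M \<ge> 1" "\<eta> / p > 0" "0 < \<rho>" "\<rho> < 1"
    using pc by (auto simp: M_def \<rho>_def ge_one_powr_ge_zero powr01_less_one)
  ultimately show ?thesis
    unfolding strongly_UGES_def by blast
qed

section \<open>The converse Lyapunov functional\<close>

text \<open>
  The supremum of the trajectory norms after the guaranteed decay has been divided out. Letting the
  initial time \<open>s\<close> vary spares a time shift when a pattern is extended into the past.
\<close>

definition worst_case_norm ::
  "(real \<Rightarrow> 'a::banach \<Rightarrow>\<^sub>L 'a) \<Rightarrow> ('a \<Rightarrow>\<^sub>L 'a) \<Rightarrow> real \<Rightarrow> real \<Rightarrow> 'a \<Rightarrow> real" where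
  "worst_case_norm S J \<alpha> \<rho> x =
     Sup {exp (\<alpha> * (t - s)) / \<rho> ^ length \<tau>s * norm (blinfun_apply (flow_through S J \<tau>s t s) x)
          | s \<tau>s t. impulse_list s \<tau>s t}"

lemma worst_case_norm_least:
  assumes "\<And>s \<tau>s t. impulse_list s \<tau>s t \<Longrightarrow>
      exp (\<alpha> * (t - s)) / \<rho> ^ length \<tau>s * norm (blinfun_apply (flow_through S J \<tau>s t s) x) \<le> B"
  shows "worst_case_norm S J \<alpha> \<rho> x \<le> B"
  unfolding worst_case_norm_def
proof (rule cSup_least)
  have "impulse_list 0 [] 0"
    by simp
  then show "{exp (\<alpha> * (t - s)) / \<rho> ^ length \<tau>s *
      norm (blinfun_apply (flow_through S J \<tau>s t s) x) | s \<tau>s t. impulse_list s \<tau>s t} \<noteq> {}"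
    by blast
qed (use assms in auto)

text \<open>
  A pattern starting at an arbitrary time is moved to start at \<open>0\<close>, where some impulse sequence
  realizes it. This bound makes the supremum finite and equivalent to the norm.
\<close>

lemma strongly_UGES_flow_through_bound:
  assumes UGES: "\<And>\<sigma> t. \<sigma> \<in> impulse_seqs \<Longrightarrow> t \<ge> 0 \<Longrightarrow>
      norm (propagator S J \<sigma> t 0) \<le> M * \<rho> ^ kappa \<sigma> t 0 * exp (- \<alpha> * t)"
    and "\<rho> > 0" and il: "impulse_list s \<tau>s t"
  shows "exp (\<alpha> * (t - s)) / \<rho> ^ length \<tau>s * norm (blinfun_apply (flow_through S J \<tau>s t s) x)
      \<le> M * norm x"
proof -
  let ?\<tau>s = "map (\<lambda>\<tau>. \<tau> + (- s)) \<tau>s"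
  have il0: "impulse_list 0 ?\<tau>s (t - s)"
    using il impulse_list_shift[of s "- s" \<tau>s t] by simp
  then obtain \<sigma> where "\<sigma> \<in> impulse_seqs" "kappa \<sigma> (t - s) 0 = length ?\<tau>s"
    "propagator S J \<sigma> (t - s) 0 = flow_through S J ?\<tau>s (t - s) 0"
    by (rule impulse_list_realized)
  moreover have "flow_through S J ?\<tau>s (t - s) 0 = flow_through S J \<tau>s t s"
    using flow_through_shift[of S J "- s" \<tau>s t s] by simp
  ultimately have "norm (flow_through S J \<tau>s t s) \<le> M * \<rho> ^ length \<tau>s * exp (- \<alpha> * (t - s))"
    using UGES[of \<sigma> "t - s"] impulse_list_le[OF il] by simp
  then have "norm (blinfun_apply (flow_through S J \<tau>s t s) x)
      \<le> M * \<rho> ^ length \<tau>s * exp (- \<alpha> * (t - s)) * norm x"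
    by (meson mult_right_mono norm_blinfun norm_ge_zero order_trans)
  then have "exp (\<alpha> * (t - s)) / \<rho> ^ length \<tau>s * norm (blinfun_apply (flow_through S J \<tau>s t s) x)
      \<le> exp (\<alpha> * (t - s)) / \<rho> ^ length \<tau>s * (M * \<rho> ^ length \<tau>s * exp (- \<alpha> * (t - s)) * norm x)"
    using \<open>\<rho> > 0\<close> by (intro mult_left_mono) auto
  also have "\<dots> = M * norm x"
    using \<open>\<rho> > 0\<close> by (simp add: exp_minus)
  finally show ?thesis .
qed

text \<open>
  The exponent is \<open>p = 1\<close>, and the constants \<open>M\<close>, \<open>\<alpha>\<close>, \<open>\<rho>\<close> of strong UGES reappear as \<open>c\<close>, \<open>\<eta>\<close>, \<open>\<mu>\<close>.
\<close>

lemma strongly_UGES_imp_lyapunov_decay: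
  assumes C0: "C0_semigroup S" and "strongly_UGES S J impulse_seqs"
  shows "\<exists>p c \<eta> \<mu> V. lyapunov_decay S J p c \<eta> \<mu> V"
proof -
  obtain M \<alpha> \<rho> where M: "M \<ge> 1" "\<alpha> > 0" "0 < \<rho>" "\<rho> < 1" and
    UGES: "\<forall>\<sigma>\<in>impulse_seqs. \<forall>t s. t \<ge> s \<and> s \<ge> 0 \<longrightarrow>
       norm (propagator S J \<sigma> t s) \<le> M * \<rho> ^ kappa \<sigma> t s * exp (- \<alpha> * (t - s))"
    using assms(2) unfolding strongly_UGES_def by (elim exE conjE) (rule that)
  define V where "V = worst_case_norm S J \<alpha> \<rho>"
  define w where "w s \<tau>s t x =
    exp (\<alpha> * (t - s)) / \<rho> ^ length \<tau>s * norm (blinfun_apply (flow_through S J \<tau>s t s) x)"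
    for s \<tau>s t x
  have w_bound: "w s \<tau>s t x \<le> M * norm x" if "impulse_list s \<tau>s t" for s \<tau>s t x
    unfolding w_def
    by (rule strongly_UGES_flow_through_bound[OF _ M(3) that]) (use UGES in force)
  have V_least: "V x \<le> B" if "\<And>s \<tau>s t. impulse_list s \<tau>s t \<Longrightarrow> w s \<tau>s t x \<le> B" for x B
    unfolding V_def by (rule worst_case_norm_least) (use that in \<open>simp add: w_def\<close>)
  have V_upper: "w s \<tau>s t x \<le> V x" if "impulse_list s \<tau>s t" for s \<tau>s t x
    unfolding V_def worst_case_norm_def
  proof (rule cSup_upper)
    show "bdd_above {exp (\<alpha> * (t - s)) / \<rho> ^ length \<tau>s *
        norm (blinfun_apply (flow_through S J \<tau>s t s) x) | s \<tau>s t. impulse_list s \<tau>s t}"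
      by (rule bdd_aboveI[where M = "M * norm x"])
         (use w_bound in \<open>auto simp only: w_def mem_Collect_eq\<close>)
  qed (use that in \<open>auto simp: w_def\<close>)
  have S0: "S 0 = id_blinfun" and Sadd: "\<And>s t. s \<ge> 0 \<Longrightarrow> t \<ge> 0 \<Longrightarrow> S (s + t) = S s o\<^sub>L S t"
    and Slim: "\<And>x. ((\<lambda>h. blinfun_apply (S h) x) \<longlongrightarrow> x) (at_right 0)"
    using C0 by (auto simp: C0_semigroup_def)
  have lower: "norm x \<le> V x" for x
    using V_upper[of 0 "[]" 0 x] by (simp add: w_def S0)
  have upper: "V x \<le> M * norm x" for x
    by (intro V_least w_bound)
  \<comment> \<open>Each rescaled norm is a seminorm, so their supremum is subadditive and hence Lipschitz.\<close>
  have w_add: "w s \<tau>s t (y + z) \<le> w s \<tau>s t y + w s \<tau>s t z" for s \<tau>s t y z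
    unfolding w_def blinfun.add_right distrib_left[symmetric]
    using M(3) by (intro mult_left_mono norm_triangle_ineq) simp
  have V_diff: "V x - V y \<le> M * norm (x - y)" for x y
  proof -
    have "V x \<le> V y + M * norm (x - y)"
    proof (rule V_least)
      fix s \<tau>s t assume il: "impulse_list s \<tau>s t"
      have "w s \<tau>s t (y + (x - y)) \<le> w s \<tau>s t y + w s \<tau>s t (x - y)"
        by (rule w_add)
      also have "\<dots> \<le> V y + M * norm (x - y)"
        by (intro add_mono V_upper w_bound il)
      finally show "w s \<tau>s t x \<le> V y + M * norm (x - y)"
        by simp
    qed
    then show ?thesis
      by simp
  qed
  have "M-lipschitz_on X V" for X
  proof (rule lipschitz_onI)
    fix x y
    show "dist (V x) (V y) \<le> M * dist x y"
      using V_diff[of x y] V_diff[of y x] by (simp add: dist_norm norm_minus_commute abs_le_iff)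
  qed (use M(1) in simp)
  then have lip: "lipschitz_on_bounded V"
    unfolding lipschitz_on_bounded_def using M(1) by (intro allI impI exI[of _ M]) simp
  \<comment> \<open>Starting earlier by \<open>h\<close> enlarges the weight by exactly the decay claimed for time \<open>h\<close>.\<close>
  have split_exp: "exp (\<alpha> * (t - s)) = exp (- (\<alpha> * h)) * exp (\<alpha> * (t - (s - h)))" for t s h
    by (simp add: exp_add[symmetric] algebra_simps)
  have decay: "V (blinfun_apply (S h) x) \<le> exp (- \<alpha> * h) * V x" if "h \<ge> 0" for h x
  proof (rule V_least)
    fix s \<tau>s t assume il: "impulse_list s \<tau>s t"
    have "blinfun_apply (flow_through S J \<tau>s t s) (blinfun_apply (S h) x) =
        blinfun_apply (flow_through S J \<tau>s t (s - h)) x"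
    proof (cases \<tau>s)
      case Nil
      with il that Sadd[of "t - s" h] show ?thesis
        by (simp add: diff_diff_eq2 diff_add_eq)
    next
      case (Cons \<tau> \<tau>s')
      with il that Sadd[of "\<tau> - s" h] show ?thesis
        by (simp add: diff_diff_eq2 diff_add_eq)
    qed
    then have "w s \<tau>s t (blinfun_apply (S h) x) = exp (- \<alpha> * h) * w (s - h) \<tau>s t x"
      by (simp add: w_def split_exp[of t s h])
    also have "\<dots> \<le> exp (- \<alpha> * h) * V x"
      using V_upper impulse_list_earlier[OF il, of "s - h"] that by simp
    finally show "w s \<tau>s t (blinfun_apply (S h) x) \<le> exp (- \<alpha> * h) * V x" .
  qed
  have jump: "V (blinfun_apply J x) \<le> \<rho> * V x" for x
  proof (rule V_least)
    fix s \<tau>s t assume il: "impulse_list s \<tau>s t"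
    \<comment> \<open>After a flow of length \<open>h\<close>, the jump is the first impulse of a pattern that starts at
      \<open>s - h\<close>; this fails for \<open>h = 0\<close>, which is reached in the limit.\<close>
    have "w s \<tau>s t (blinfun_apply J (blinfun_apply (S h) x)) \<le> \<rho> * (exp (- \<alpha> * h) * V x)"
      if "h > 0" for h
    proof -
      have "w s \<tau>s t (blinfun_apply J (blinfun_apply (S h) x)) =
          \<rho> * (exp (- \<alpha> * h) * w (s - h) (s # \<tau>s) t x)"
        using M(3) by (simp add: w_def split_exp[of t s h])
      also have "\<dots> \<le> \<rho> * (exp (- \<alpha> * h) * V x)"
        using M(3) il that by (intro mult_left_mono V_upper) auto
      finally show ?thesis .
    qed
    then have "\<forall>\<^sub>F h in at_right 0.
        w s \<tau>s t (blinfun_apply J (blinfun_apply (S h) x)) \<le> \<rho> * (exp (- \<alpha> * h) * V x)"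
      by (intro eventually_at_rightI[of 0 1]) auto
    moreover have "((\<lambda>h. w s \<tau>s t (blinfun_apply J (blinfun_apply (S h) x))) \<longlongrightarrow>
        w s \<tau>s t (blinfun_apply J x)) (at_right 0)"
      unfolding w_def by (intro tendsto_intros Slim)
    moreover have "((\<lambda>h. \<rho> * (exp (- \<alpha> * h) * V x)) \<longlongrightarrow> \<rho> * (exp (- \<alpha> * 0) * V x)) (at_right 0)"
      by (intro tendsto_intros)
    ultimately show "w s \<tau>s t (blinfun_apply J x) \<le> \<rho> * V x"
      using tendsto_le[OF trivial_limit_at_right_real] by fastforce
  qed
  have "lyapunov_decay S J 1 M \<alpha> \<rho> V"
    unfolding lyapunov_decay_def
    using M lower upper lip decay jump order_trans[OF norm_ge_zero lower] by auto
  then show ?thesis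
    by blast
qed

section \<open>Equivalence of stability and the two Lyapunov conditions\<close>

theorem theorem5p2:
  fixes S :: "real \<Rightarrow> 'a::banach \<Rightarrow>\<^sub>L 'a"
    and A :: "'a \<Rightarrow> 'a" and D :: "'a set"
    and J :: "'a \<Rightarrow>\<^sub>L 'a"
  assumes "generates D A S"
    and "J \<noteq> 0"
    and "blinfun_apply J ` D \<subseteq> D"
    and "growth_condition S J impulse_seqs"
  shows "(strongly_UGES S J impulse_seqs \<longleftrightarrow>
            (\<exists>p c \<eta> \<mu> V. lyapunov_infinitesimal S J p c \<eta> \<mu> V)) \<and>
         ((\<exists>p c \<eta> \<mu> V. lyapunov_infinitesimal S J p c \<eta> \<mu> V) \<longleftrightarrow>
            (\<exists>p c \<eta> \<mu> V. lyapunov_decay S J p c \<eta> \<mu> V)) \<and>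
         (\<forall>V. (\<exists>p c \<eta> \<mu>. lyapunov_infinitesimal S J p c \<eta> \<mu> V) \<longrightarrow>
            (\<exists>p c \<eta> \<mu>. lyapunov_decay S J p c \<eta> \<mu> V))"
proof -
  have C0: "C0_semigroup S"
    using assms(1) by (simp add: generates_def)
  obtain G where G: "\<And>t x. t \<ge> 0 \<Longrightarrow> norm (blinfun_apply (S t) x) \<le> G * norm x"
    using growth_condition_bounds_semigroup[OF assms(4)] by blast
  have iff: "lyapunov_infinitesimal S J p c \<eta> \<mu> V \<longleftrightarrow> lyapunov_decay S J p c \<eta> \<mu> V"
    for p c \<eta> \<mu> V
    using lyapunov_infinitesimal_imp_decay[OF C0 G] lyapunov_decay_imp_infinitesimal by blast
  have "strongly_UGES S J impulse_seqs \<longleftrightarrow> (\<exists>p c \<eta> \<mu> V. lyapunov_decay S J p c \<eta> \<mu> V)"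
    using strongly_UGES_imp_lyapunov_decay[OF C0] lyapunov_decay_imp_strongly_UGES by blast
  then show ?thesis
    unfolding iff by blast
qed

end
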